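(* Under the Decomposition Mechanism and the Weight Mechanism, an honest-but-curious node $i$ cannot infer the initial state $x_j[0]$ of node $j$ (another node, $j\neq i$) with any guaranteed accuracy if node $j$ has at least one neighboring node $m$ who does not collude with node $i$ to infer $x_j[0]$.
   Context: Network: $G=(V,E)$ is an undirected connected graph with nodes $v_1,\dots,v_M$ (node $p$ means $v_p$). $N_p=\{v_q:(v_p,v_q)\in E\}$ is the set of neighbors of node $p$, and $\Delta=\max_p|N_p|$. Coupling weights $a_{pq}[k]=a_{qp}[k]$ at times $k=0,1,2,\dots$ are attached to edges ($a_{pq}[k]=0$ if $(v_p,v_q)\notin E$). Each node $p$ has a scalar real initial state $x_p[0]$, and the nodes wish to reach consensus on the average $\frac1M\sum_p x_p[0]$. Decomposition Mechanism: each node $p$ decomposes its state into two sub-states $x_p^{\alpha}$ and $x_p^{\beta}$, whose initial values $x_p^{\alpha}[0],x_p^{\beta}[0]$ are randomly chosen from the set of all real numbers under the constraint $x_p^{\alpha}[0]+x_p^{\beta}[0]=2x_p[0]$. The sub-state $x_p^{\alpha}$ is the only state value of node $p$ exchanged with its neighbors. The sub-state $x_p^{\beta}$ interacts only with $x_p^{\alpha}$, through a symmetric coupling weight $a_{p,\alpha\beta}[k]$, and is invisible to other nodes. The values $a_{p,\alpha\beta}[k]$ are private to node $p$. The dynamics are, for $k\ge0$, $$x_p^{\alpha}[k+1]=x_p^{\alpha}[k]+\varepsilon\sum_{v_q\in N_p}a_{pq}[k](x_q^{\alpha}[k]-x_p^{\alpha}[k])+\varepsilon a_{p,\alpha\beta}[k](x_p^{\beta}[k]-x_p^{\alpha}[k]),$$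 $$x_p^{\beta}[k+1]=x_p^{\beta}[k]+\varepsilon a_{p,\alpha\beta}[k](x_p^{\alpha}[k]-x_p^{\beta}[k]),$$ with $\varepsilon\in(0,\frac1{\Delta+1}]$. Weight Mechanism: for $k=0$, all weights $a_{pq}[0]$ (on edges) and $a_{p,\alpha\beta}[0]$ are allowed to be arbitrarily chosen from the set of all real numbers under the constraint $a_{pq}[0]=a_{qp}[0]$. For $k=1,2,\dots$, there is a scalar $0<\eta<1$ such that all nonzero $a_{pq}[k]$ (those on edges) satisfy $\eta\le a_{pq}[k]<1$ and all $a_{p,\alpha\beta}[k]$ satisfy $\eta\le a_{p,\alpha\beta}[k]<1$. Adversary: an honest-but-curious node follows all protocol steps correctly but collects received data in an attempt to learn information about other participating nodes. The information accessible to node $i$ is $I_i=\bigcup_{k\ge0}I_i[k]$, where $I_i[k]$ consists of $a_{ip}[k]$ and $x_p^{\alpha}[k]$ for all $v_p\in N_i$, together with $x_i^{\alpha}[k]$, $x_i^{\beta}[k]$, $a_{i,\alpha\beta}[k]$, and node $i$'s own initial state $x_i[0]$. A node colludes with node $i$ to infer $x_j[0]$ if it shares its own accessible information with node $i$ for that purpose. A non-colluding node $m$ may still exchange information with node $i$ as the protocol prescribes. Privacy: the privacy of $x_j[0]$ is preserved if an adversary cannot estimate the value of $x_j[0]$ with any guaranteed accuracy. This requires that the adversary cannot even find a range for $x_j[0]$ from the information accessible to it.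
   Formalization: The claim is proved for almost every random choice of the initial sub-states (Lebesgue measure), not for every choice: it can fail when node j and its only non-colluding neighbor m happen to start with equal exchanged sub-states. *)

theory Defs
  imports "HOL-Analysis.Analysis"
begin

text \<open>The nodes are the elements of a finite type; the edge set is a symmetric irreflexive relation.\<close>

definition network :: "('n::finite \<times> 'n) set \<Rightarrow> bool" where
  "network E \<longleftrightarrow> sym E \<and> irrefl E \<and> (\<forall>p q. (p, q) \<in> E\<^sup>*)"

definition neighbors :: "('n::finite \<times> 'n) set \<Rightarrow> 'n \<Rightarrow> 'n set" where
  "neighbors E p = {q. (p, q) \<in> E}"

definition max_degree :: "('n::finite \<times> 'n) set \<Rightarrow> nat" where
  "max_degree E = Max (range (\<lambda>p. card (neighbors E p)))"

text \<open>
  A run consists of the initial states \<open>x\<^sub>p[0]\<close> (\<open>init\<close>), the sub-states \<open>x\<^sub>p\<^sup>\<alpha>[k]\<close> and \<open>x\<^sub>p\<^sup>\<beta>[k]\<close>,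
  the coupling weights \<open>a\<^sub>p\<^sub>q[k]\<close> (\<open>weight\<close>) and the private weights between the two sub-states of
  each node (\<open>coupling\<close>).
\<close>

record 'n run =
  init :: "'n \<Rightarrow> real"
  alpha :: "'n \<Rightarrow> nat \<Rightarrow> real"
  beta :: "'n \<Rightarrow> nat \<Rightarrow> real"
  weight :: "'n \<Rightarrow> 'n \<Rightarrow> nat \<Rightarrow> real"
  coupling :: "'n \<Rightarrow> nat \<Rightarrow> real"

text \<open>
  The random choice of the initial sub-states is not part of the following predicate: the constraint
  leaves \<open>\<lambda>p. alpha R p 0\<close> free and determines \<open>\<lambda>p. beta R p 0\<close>, and a property that holds for
  Lebesgue-almost all values of the former holds with probability one under every absolutely
  continuous distribution.
\<close>

definition decomposition_mechanism :: "('n::finite \<times> 'n) set \<Rightarrow> real \<Rightarrow> 'n run \<Rightarrow> bool" where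
  "decomposition_mechanism E \<epsilon> R \<longleftrightarrow>
     (\<forall>p. alpha R p 0 + beta R p 0 = 2 * init R p) \<and>
     (\<forall>p k. alpha R p (Suc k) =
        alpha R p k
        + \<epsilon> * (\<Sum>q\<in>neighbors E p. weight R p q k * (alpha R q k - alpha R p k))
        + \<epsilon> * coupling R p k * (beta R p k - alpha R p k)) \<and>
     (\<forall>p k. beta R p (Suc k) =
        beta R p k + \<epsilon> * coupling R p k * (alpha R p k - beta R p k))"

text \<open>At time 0 the weights on edges and the private weights are arbitrary reals, up to symmetry.\<close>

definition weight_mechanism :: "('n::finite \<times> 'n) set \<Rightarrow> real \<Rightarrow> 'n run \<Rightarrow> bool" where
  "weight_mechanism E \<eta> R \<longleftrightarrow>
     (\<forall>p q k. weight R p q k = weight R q p k) \<and>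
     (\<forall>p q k. (p, q) \<notin> E \<longrightarrow> weight R p q k = 0) \<and>
     (\<forall>p q k. (p, q) \<in> E \<and> k \<ge> 1 \<longrightarrow> \<eta> \<le> weight R p q k \<and> weight R p q k < 1) \<and>
     (\<forall>p k. k \<ge> 1 \<longrightarrow> \<eta> \<le> coupling R p k \<and> coupling R p k < 1)"

definition protocol_run :: "('n::finite \<times> 'n) set \<Rightarrow> real \<Rightarrow> real \<Rightarrow> 'n run \<Rightarrow> bool" where
  "protocol_run E \<epsilon> \<eta> R \<longleftrightarrow> decomposition_mechanism E \<epsilon> R \<and> weight_mechanism E \<eta> R"

text \<open>
  Each observed value is tagged with the quantity it is the value of, so that two runs give equal
  information sets iff they agree on every observed quantity.
\<close>

datatype 'n observation =
    Obs_init 'n real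
  | Obs_alpha 'n nat real
  | Obs_beta 'n nat real
  | Obs_weight 'n 'n nat real
  | Obs_coupling 'n nat real

definition info_at :: "('n::finite \<times> 'n) set \<Rightarrow> 'n run \<Rightarrow> 'n \<Rightarrow> nat \<Rightarrow> 'n observation set" where
  "info_at E R i k =
     (\<Union>p\<in>neighbors E i. {Obs_weight i p k (weight R i p k), Obs_alpha p k (alpha R p k)}) \<union>
     {Obs_alpha i k (alpha R i k), Obs_beta i k (beta R i k),
      Obs_coupling i k (coupling R i k), Obs_init i (init R i)}"

definition info :: "('n::finite \<times> 'n) set \<Rightarrow> 'n run \<Rightarrow> 'n \<Rightarrow> 'n observation set" where
  "info E R i = (\<Union>k. info_at E R i k)"

text \<open>What node \<open>i\<close> knows when the nodes in \<open>C\<close> collude with it.\<close>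

definition collusion_info ::
  "('n::finite \<times> 'n) set \<Rightarrow> 'n run \<Rightarrow> 'n \<Rightarrow> 'n set \<Rightarrow> 'n observation set" where
  "collusion_info E R i C = (\<Union>p\<in>insert i C. info E R p)"

text \<open>
  The adversary knows the protocol, including \<open>E\<close>, \<open>\<epsilon>\<close> and \<open>\<eta>\<close>. After the run \<open>R\<close> it has found the
  range \<open>S\<close> for the initial state of \<open>j\<close> if that state lies in \<open>S\<close> in every run that is consistent
  with its information. A range is any interval, bounded or not, other than the whole line.
\<close>

definition finds_range ::
  "('n::finite \<times> 'n) set \<Rightarrow> real \<Rightarrow> real \<Rightarrow> 'n \<Rightarrow> 'n set \<Rightarrow> 'n \<Rightarrow> 'n run \<Rightarrow> real set \<Rightarrow> bool" where
  "finds_range E \<epsilon> \<eta> i C j R S \<longleftrightarrow>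
     is_interval S \<and> S \<noteq> UNIV \<and>
     (\<forall>R'. protocol_run E \<epsilon> \<eta> R' \<and> collusion_info E R' i C = collusion_info E R i C
           \<longrightarrow> init R' j \<in> S)"

definition privacy_preserved ::
  "('n::finite \<times> 'n) set \<Rightarrow> real \<Rightarrow> real \<Rightarrow> 'n \<Rightarrow> 'n set \<Rightarrow> 'n \<Rightarrow> 'n run \<Rightarrow> bool" where
  "privacy_preserved E \<epsilon> \<eta> i C j R \<longleftrightarrow> (\<nexists>S. finds_range E \<epsilon> \<eta> i C j R S)"

text \<open>In particular, no estimate of the initial state has a guaranteed accuracy \<open>\<delta>\<close>.\<close>

lemma privacy_preserved_no_accuracy:
  assumes "privacy_preserved E \<epsilon> \<eta> i C j R"
  shows "\<exists>R'. protocol_run E \<epsilon> \<eta> R' \<and> collusion_info E R' i C = collusion_info E R i C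
              \<and> \<bar>init R' j - estimate\<bar> > \<delta>"
proof (rule ccontr)
  assume *: "\<not> ?thesis"
  let ?S = "{estimate - \<delta>..estimate + \<delta>}"
  have "estimate + \<bar>\<delta>\<bar> + 1 \<notin> ?S" by auto
  then have "?S \<noteq> UNIV" by blast
  moreover have "init R' j \<in> ?S"
    if "protocol_run E \<epsilon> \<eta> R' \<and> collusion_info E R' i C = collusion_info E R i C" for R'
  proof -
    have "\<bar>init R' j - estimate\<bar> \<le> \<delta>"
      using * that by (meson not_less)
    then show ?thesis
      by auto
  qed
  ultimately have "finds_range E \<epsilon> \<eta> i C j R ?S"
    unfolding finds_range_def using is_interval_cc by blast
  with assms show False
    unfolding privacy_preserved_def by blast
qed

end

theory Submission
  imports Defs
begin

text \<open>
  Shift the initial state of \<open>j\<close> by \<open>d\<close> and that of \<open>m\<close> by \<open>-d\<close>, and absorb both shifts in the hidden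
  initial values \<open>x\<^sub>j\<^sup>\<beta>[0]\<close> and \<open>x\<^sub>m\<^sup>\<beta>[0]\<close>. The private weights of \<open>j\<close> and \<open>m\<close> at time 0, which are arbitrary
  reals, can be adjusted so that \<open>x\<^sub>j\<^sup>\<beta>[1]\<close> and \<open>x\<^sub>m\<^sup>\<beta>[1]\<close> do not change; this perturbs \<open>x\<^sub>j\<^sup>\<alpha>[1]\<close> and
  \<open>x\<^sub>m\<^sup>\<alpha>[1]\<close> by \<open>2d\<close> and \<open>-2d\<close>, and a change of \<open>a\<^sub>j\<^sub>m[0]\<close> cancels both perturbations, provided
  \<open>x\<^sub>j\<^sup>\<alpha>[0] \<noteq> x\<^sub>m\<^sup>\<alpha>[0]\<close>. That fails only on a hyperplane. Two values of \<open>d\<close> have to be left out (where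
  the new sub-states of \<open>j\<close> or of \<open>m\<close> coincide at time 0), but an interval that contains all other
  reals is the whole line.
\<close>

lemma protocol_run_shift_init:
  fixes E :: "('n::finite \<times> 'n) set" and R :: "'n run"
  assumes run: "protocol_run E \<epsilon> \<eta> R" and "0 < \<epsilon>"
    and edge: "(j, m) \<in> E" "(m, j) \<in> E" and "j \<noteq> m"
    and jm: "alpha R j 0 \<noteq> alpha R m 0"
    and j: "y \<noteq> alpha R j 0"
    and m: "y \<noteq> init R j + init R m - alpha R m 0"
  obtains R' where "protocol_run E \<epsilon> \<eta> R'" "init R' j = y"
    "\<And>p. j \<noteq> p \<Longrightarrow> m \<noteq> p \<Longrightarrow> info E R' p = info E R p"
proof -
  define d where "d = y - init R j"
  \<comment> \<open>As \<open>alpha\<close> stays fixed, the constraint on the sub-states turns a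
    shift \<open>d\<close> of the initial state into a shift \<open>2 * d\<close> of the hidden
    one.\<close>
  define e where "e p = (if p = j then 2 * d else if p = m then - 2 * d else 0)" for p
  define \<delta> where "\<delta> = - 2 * d / (\<epsilon> * (alpha R m 0 - alpha R j 0))"
  define w where "w p q k = weight R p q k +
    (if k = 0 \<and> (p = j \<and> q = m \<or> p = m \<and> q = j) then \<delta> else 0)" for p q and k :: nat
  define b where "b p k = beta R p k + (if k = 0 then e p else 0)" for p and k :: nat
  \<comment> \<open>The value at time 0 solves the equation \<open>flow\<close> below; its
    denominator is nonzero by \<open>nz\<close>.\<close>
  define c where "c p k = (if k = 0 \<and> (p = j \<or> p = m)
    then (\<epsilon> * coupling R p 0 * (beta R p 0 - alpha R p 0) + e p) / (\<epsilon> * (b p 0 - alpha R p 0))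
    else coupling R p k)" for p and k :: nat
  define R' where
    "R' = R\<lparr>init := \<lambda>p. init R p + e p / 2, beta := b, weight := w, coupling := c\<rparr>"
  have sel: "init R' p = init R p + e p / 2" "alpha R' = alpha R" "beta R' = b"
    "weight R' = w" "coupling R' = c" for p
    by (auto simp: R'_def)
  have dm: "decomposition_mechanism E \<epsilon> R" and wm: "weight_mechanism E \<eta> R"
    using run by (auto simp: protocol_run_def)
  have init: "alpha R p 0 + beta R p 0 = 2 * init R p" for p
    using dm by (simp add: decomposition_mechanism_def)
  have nz: "b p 0 - alpha R p 0 \<noteq> 0" if "p = j \<or> p = m" for p
    using that j m init[of j] init[of m] \<open>j \<noteq> m\<close> by (auto simp: b_def e_def d_def)
  \<comment> \<open>At time 0 the hidden sub-state hands over exactly its surplus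
    \<open>e p\<close>, so \<open>b\<close> agrees with \<open>beta R\<close> from time 1
    on.\<close>
  have flow: "\<epsilon> * c p k * (b p k - alpha R p k) =
      \<epsilon> * coupling R p k * (beta R p k - alpha R p k) + (if k = 0 then e p else 0)" for p k
  proof (cases "k = 0 \<and> (p = j \<or> p = m)")
    case True
    then show ?thesis
      using nz[of p] \<open>0 < \<epsilon>\<close> by (simp add: c_def)
  next
    case False
    then show ?thesis
      by (auto simp: c_def b_def e_def)
  qed
  have \<delta>: "\<epsilon> * (\<delta> * (alpha R m 0 - alpha R j 0)) = - 2 * d"
    using jm \<open>0 < \<epsilon>\<close> by (simp add: \<delta>_def)
  \<comment> \<open>The edge takes the same surplus away: the difference of the visible sub-states
    changes sign with the endpoint, as \<open>e\<close> does, so one symmetric change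
    \<open>\<delta>\<close> serves both.\<close>
  have exch: "\<epsilon> * (\<Sum>q\<in>neighbors E p. w p q k * (alpha R q k - alpha R p k)) =
      \<epsilon> * (\<Sum>q\<in>neighbors E p. weight R p q k * (alpha R q k - alpha R p k))
      - (if k = 0 then e p else 0)" for p k
  proof -
    \<comment> \<open>The other endpoint; for a third node \<open>j\<close> is a dummy, since the
      correction is then 0.\<close>
    define r where "r = (if p = j then m else j)"
    have "(\<Sum>q\<in>neighbors E p. w p q k * (alpha R q k - alpha R p k)) =
        (\<Sum>q\<in>neighbors E p. weight R p q k * (alpha R q k - alpha R p k)
          + (if q = r then if k = 0 \<and> (p = j \<or> p = m) then \<delta> * (alpha R r 0 - alpha R p 0) else 0
             else 0))"
      using \<open>j \<noteq> m\<close> by (intro sum.cong) (auto simp: w_def r_def algebra_simps)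
    also have "\<dots> = (\<Sum>q\<in>neighbors E p. weight R p q k * (alpha R q k - alpha R p k))
        + (if k = 0 \<and> (p = j \<or> p = m) then \<delta> * (alpha R r 0 - alpha R p 0) else 0)"
      using edge by (auto simp: sum.distrib neighbors_def r_def)
    finally show ?thesis
      using \<delta> \<open>j \<noteq> m\<close> by (auto simp: r_def e_def algebra_simps)
  qed
  have "decomposition_mechanism E \<epsilon> R'"
    unfolding decomposition_mechanism_def sel
  proof (intro conjI allI)
    fix p k
    show "alpha R p 0 + b p 0 = 2 * (init R p + e p / 2)"
      using init[of p] by (simp add: b_def)
    have "alpha R p (Suc k) = alpha R p k
        + \<epsilon> * (\<Sum>q\<in>neighbors E p. weight R p q k * (alpha R q k - alpha R p k))
        + \<epsilon> * coupling R p k * (beta R p k - alpha R p k)"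
      using dm by (simp add: decomposition_mechanism_def)
    then show "alpha R p (Suc k) = alpha R p k
        + \<epsilon> * (\<Sum>q\<in>neighbors E p. w p q k * (alpha R q k - alpha R p k))
        + \<epsilon> * c p k * (b p k - alpha R p k)"
      unfolding exch flow by simp
    have "beta R p (Suc k) = beta R p k + \<epsilon> * coupling R p k * (alpha R p k - beta R p k)"
      using dm by (simp add: decomposition_mechanism_def)
    then show "b p (Suc k) = b p k + \<epsilon> * c p k * (alpha R p k - b p k)"
      using flow[of p k] by (simp add: b_def algebra_simps split: if_splits)
  qed
  moreover have "weight_mechanism E \<eta> R'"
    using wm edge unfolding weight_mechanism_def sel by (auto simp: w_def c_def)
  ultimately have "protocol_run E \<epsilon> \<eta> R'"
    by (simp add: protocol_run_def)
  moreover have "init R' j = y"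
    by (simp add: sel e_def d_def field_simps)
  \<comment> \<open>Only private data of \<open>j\<close> and \<open>m\<close> and the weight of
    their common edge differ; a third node observes none of these.\<close>
  moreover have "info E R' p = info E R p" if "j \<noteq> p" "m \<noteq> p" for p
    using that by (auto simp: info_def info_at_def sel w_def b_def c_def e_def)
  ultimately show thesis
    using that by blast
qed

text \<open>A missing point would lie between two points of \<open>S\<close>, since both open
  half-lines at it are infinite and so meet \<open>S\<close>.\<close>

lemma is_interval_cofinite_eq_UNIV:
  fixes S :: "real set"
  assumes S: "is_interval S" and fin: "finite (- S)"
  shows "S = UNIV"
proof (rule ccontr)
  assume "S \<noteq> UNIV"
  then obtain z where z: "z \<notin> S"
    by blast
  have "infinite {..<z}" "infinite {z<..}"
    by (simp_all add: infinite_Iio infinite_Ioi)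
  then obtain u v where "u \<in> S" "u < z" "v \<in> S" "z < v"
    using finite_subset[OF _ fin] by (metis ComplI greaterThan_iff lessThan_iff subsetI)
  then have "z \<in> S"
    using S by (meson is_interval_1 less_imp_le)
  with z show False ..
qed

lemma AE_lborel_components_neq:
  fixes j m :: "'n::finite"
  assumes "j \<noteq> m"
  shows "AE a in (lborel :: (real ^ 'n) measure). a $ j \<noteq> a $ m"
proof -
  let ?v = "axis j 1 - axis m 1 :: real ^ 'n" and ?H = "{a :: real ^ 'n. a $ j = a $ m}"
  have "?v \<noteq> 0"
    using assms by (simp add: axis_eq_axis)
  moreover have "?H = {a. ?v \<bullet> a = 0}"
    by (simp add: inner_diff_left inner_axis')
  ultimately have "negligible ?H"
    using negligible_hyperplane[of ?v 0] by simp
  \<comment> \<open>Closedness makes \<open>?H\<close> Borel, hence null for \<open>lborel\<close>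
    itself and not only for its completion.\<close>
  moreover have "closed ?H"
    by (intro closed_Collect_eq continuous_intros)
  ultimately have "?H \<in> null_sets lborel"
    by (simp add: negligible_iff_null_sets null_sets_completion_iff)
  then show ?thesis
    by (auto dest: AE_not_in)
qed


theorem theorem2:
  fixes E :: "('n::finite \<times> 'n) set"
    and \<epsilon> \<eta> :: real
    and i j :: 'n
    and C :: "'n set"
    and x0 :: "'n \<Rightarrow> real"
  assumes "network E"
    and "0 < \<epsilon>" and "\<epsilon> \<le> 1 / (real (max_degree E) + 1)"
    and "0 < \<eta>" and "\<eta> < 1"
    and "j \<noteq> i" and "j \<notin> C"
    and "\<exists>m\<in>neighbors E j. m \<noteq> i \<and> m \<notin> C"
  shows "AE a in (lborel :: (real ^ 'n) measure).
           \<forall>R. protocol_run E \<epsilon> \<eta> R \<and> init R = x0 \<and> (\<forall>p. alpha R p 0 = a $ p)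
               \<longrightarrow> privacy_preserved E \<epsilon> \<eta> i C j R"
proof -
  obtain m where m: "m \<in> neighbors E j" "m \<noteq> i" "m \<notin> C"
    using assms(8) by blast
  then have edge: "(j, m) \<in> E" "(m, j) \<in> E" and "j \<noteq> m"
    using \<open>network E\<close> by (auto simp: network_def neighbors_def sym_def irrefl_def)
  \<comment> \<open>The only condition on a run concerns \<open>alpha\<close> at time 0, and
    \<open>m\<close> is fixed beforehand, so one null set serves all runs.\<close>
  have preserved: "privacy_preserved E \<epsilon> \<eta> i C j R"
    if run: "protocol_run E \<epsilon> \<eta> R" and neq: "alpha R j 0 \<noteq> alpha R m 0" for R
    unfolding privacy_preserved_def
  proof
    assume "\<exists>S. finds_range E \<epsilon> \<eta> i C j R S"
    then obtain S where S: "is_interval S" "S \<noteq> UNIV"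
      and found: "\<And>R'. protocol_run E \<epsilon> \<eta> R' \<Longrightarrow>
        collusion_info E R' i C = collusion_info E R i C \<Longrightarrow> init R' j \<in> S"
      unfolding finds_range_def by blast
    have "y \<in> S" if y: "y \<noteq> alpha R j 0" "y \<noteq> init R j + init R m - alpha R m 0" for y
    proof -
      obtain R' where R': "protocol_run E \<epsilon> \<eta> R'" "init R' j = y"
        "\<And>p. j \<noteq> p \<Longrightarrow> m \<noteq> p \<Longrightarrow> info E R' p = info E R p"
        using protocol_run_shift_init[OF run \<open>0 < \<epsilon>\<close> edge \<open>j \<noteq> m\<close> neq y] by blast
      have "collusion_info E R' i C = collusion_info E R i C"
        unfolding collusion_info_def
        using m \<open>j \<noteq> i\<close> \<open>j \<notin> C\<close> by (intro SUP_cong R'(3)) auto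
      with found R'(1,2) show ?thesis
        by blast
    qed
    then have "- S \<subseteq> {alpha R j 0, init R j + init R m - alpha R m 0}"
      by blast
    then have "finite (- S)"
      by (rule finite_subset) simp
    with S show False
      using is_interval_cofinite_eq_UNIV by blast
  qed
  show ?thesis
    using AE_lborel_components_neq[OF \<open>j \<noteq> m\<close>] by eventually_elim (auto intro!: preserved)
qed

end
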